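(* Let $a,b$ be coprime positive integers and $m$ a positive integer. Then $\mathcal{I}(a\cdot b,m)=\mathcal{I}(a,m)\cdot\mathcal{I}(b,m)$.
   Context: For a positive integer $n$, $\mathbb{Z}_n=\mathbb{Z}/n\mathbb{Z}$. Two points $(u_1,\dots,u_m),(v_1,\dots,v_m)\in\mathbb{Z}_n^m$ are at integral distance if there exists $d\in\mathbb{Z}_n$ with $\sum_{i=1}^m(u_i-v_i)^2=d^2$ in $\mathbb{Z}_n$. An integral point set over $\mathbb{Z}_n^m$ is a subset of $\mathbb{Z}_n^m$ whose points are pairwise at integral distance. $\mathcal{I}(n,m)$ denotes the maximum cardinality of an integral point set over $\mathbb{Z}_n^m$. *)

theory Defs
  imports "HOL-Number_Theory.Cong" "HOL-Library.FuncSet"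
begin

text \<open>
  The ring of integers modulo \<open>n\<close> is represented by the canonical residues \<open>0, \<dots>, n - 1\<close>,
  with equality in the ring being congruence modulo \<open>n\<close>. Points of its \<open>m\<close>-th power are
  extensional functions on \<open>{1..m}\<close>, so that distinct functions are distinct points and
  \<open>card\<close> counts points.
\<close>

definition Zmod :: "nat \<Rightarrow> int set" where
  "Zmod n = {0..<int n}"

definition Zmod_space :: "nat \<Rightarrow> nat \<Rightarrow> (nat \<Rightarrow> int) set" where
  "Zmod_space n m = {1..m} \<rightarrow>\<^sub>E Zmod n"

definition integral_distance :: "nat \<Rightarrow> nat \<Rightarrow> (nat \<Rightarrow> int) \<Rightarrow> (nat \<Rightarrow> int) \<Rightarrow> bool" where
  "integral_distance n m u v \<longleftrightarrow>
     (\<exists>d\<in>Zmod n. [(\<Sum>i=1..m. (u i - v i)\<^sup>2) = d\<^sup>2] (mod int n))"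

definition integral_point_set :: "nat \<Rightarrow> nat \<Rightarrow> (nat \<Rightarrow> int) set \<Rightarrow> bool" where
  "integral_point_set n m S \<longleftrightarrow>
     S \<subseteq> Zmod_space n m \<and> pairwise (integral_distance n m) S"

definition max_integral_card :: "nat \<Rightarrow> nat \<Rightarrow> nat" where
  "max_integral_card n m = Max (card ` {S. integral_point_set n m S})"

text \<open>The maximum is taken over a finite nonempty set, hence it is attained.\<close>

lemma finite_integral_point_sets: "finite {S. integral_point_set n m S}"
proof -
  have "finite (Zmod_space n m)"
    by (simp add: Zmod_space_def Zmod_def finite_PiE)
  then have "finite (Pow (Zmod_space n m))"
    by simp
  then show ?thesis
    by (rule rev_finite_subset) (auto simp: integral_point_set_def)
qed

lemma integral_point_set_empty: "integral_point_set n m {}"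
  by (simp add: integral_point_set_def)

end

theory Submission
  imports Defs
begin

text \<open>
  By the Chinese remainder theorem, reduction modulo \<open>a\<close> and \<open>b\<close> identifies the space over
  \<open>a * b\<close> with the product of the spaces over \<open>a\<close> and \<open>b\<close>, and an integer is a square modulo
  \<open>a * b\<close> iff it is one modulo both factors. So a product of integral point sets is integral, and
  every integral point set lies in the product of its two projections, which are integral.
\<close>

text \<open>The restriction to \<open>{1..m}\<close> makes the result extensional, so any
  integer-valued function, such as a coordinatewise Chinese remainder lift, becomes a genuine
  point.\<close>

definition reduce :: "nat \<Rightarrow> nat \<Rightarrow> (nat \<Rightarrow> int) \<Rightarrow> nat \<Rightarrow> int" where
  "reduce n m u = (\<lambda>i\<in>{1..m}. u i mod int n)"

lemma reduce_in_Zmod_space: "n > 0 \<Longrightarrow> reduce n m u \<in> Zmod_space n m"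
  by (auto simp: reduce_def Zmod_space_def Zmod_def)

text \<open>Replacing \<open>d\<close> by \<open>d mod int n\<close> keeps its square modulo
  \<open>n\<close>. Square roots may thus be arbitrary integers below, with no normalisation of
  witnesses.\<close>

lemma integral_distance_iff:
  assumes "n > 0"
  shows "integral_distance n m u v \<longleftrightarrow> (\<exists>d. [(\<Sum>i=1..m. (u i - v i)\<^sup>2) = d\<^sup>2] (mod int n))"
proof
  assume "\<exists>d. [(\<Sum>i=1..m. (u i - v i)\<^sup>2) = d\<^sup>2] (mod int n)"
  then obtain d where "[(\<Sum>i=1..m. (u i - v i)\<^sup>2) = d\<^sup>2] (mod int n)" by blast
  then have "[(\<Sum>i=1..m. (u i - v i)\<^sup>2) = (d mod int n)\<^sup>2] (mod int n)"
    by (simp add: cong_def power_mod)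
  moreover have "d mod int n \<in> Zmod n" using assms by (simp add: Zmod_def)
  ultimately show "integral_distance n m u v" unfolding integral_distance_def by blast
qed (auto simp: integral_distance_def)

lemma integral_distance_refl: "n > 0 \<Longrightarrow> integral_distance n m u u"
  by (auto simp: integral_distance_iff intro: exI[of _ 0])

text \<open>Reducing the coordinates changes the sum of squares only by a multiple of
  \<open>n\<close>.\<close>

lemma integral_distance_reduce:
  assumes "n > 0"
  shows "integral_distance n m (reduce n m u) (reduce n m v) \<longleftrightarrow> integral_distance n m u v"
proof -
  have "[(\<Sum>i=1..m. (reduce n m u i - reduce n m v i)\<^sup>2) = (\<Sum>i=1..m. (u i - v i)\<^sup>2)] (mod int n)"
    by (intro cong_sum cong_pow cong_diff) (simp_all add: reduce_def cong_def)
  then show ?thesis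
    unfolding integral_distance_iff[OF assms] by (simp add: cong_def)
qed

text \<open>A root modulo \<open>a * b\<close> serves both factors, as each divides the product.
  Conversely, a root \<open>d\<close> modulo \<open>a\<close> and a root \<open>e\<close> modulo
  \<open>b\<close> are glued by the Chinese remainder theorem into a single
  \<open>f\<close>.\<close>

lemma integral_distance_mult_iff:
  assumes "a > 0" and "b > 0" and "coprime a b"
  shows "integral_distance (a * b) m u v \<longleftrightarrow> integral_distance a m u v \<and> integral_distance b m u v"
proof -
  let ?s = "\<Sum>i=1..m. (u i - v i)\<^sup>2"
  have cop: "coprime (int a) (int b)" using assms by simp
  have "(\<exists>d. [?s = d\<^sup>2] (mod int (a * b))) \<longleftrightarrow>
        (\<exists>d. [?s = d\<^sup>2] (mod int a)) \<and> (\<exists>d. [?s = d\<^sup>2] (mod int b))" (is "?L \<longleftrightarrow> ?R")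
  proof
    assume ?L
    then obtain d where "[?s = d\<^sup>2] (mod int (a * b))" by blast
    then have "[?s = d\<^sup>2] (mod int a)" "[?s = d\<^sup>2] (mod int b)"
      by (rule cong_dvd_modulus; simp)+
    then show ?R by blast
  next
    assume ?R
    then obtain d e where de: "[?s = d\<^sup>2] (mod int a)" "[?s = e\<^sup>2] (mod int b)" by blast
    obtain f where f: "[f = d] (mod int a)" "[f = e] (mod int b)"
      using binary_chinese_remainder_int[OF cop] by blast
    have "[?s = f\<^sup>2] (mod int a)" "[?s = f\<^sup>2] (mod int b)"
      using de cong_pow[OF f(1), of 2] cong_pow[OF f(2), of 2] by (meson cong_sym cong_trans)+
    then have "[?s = f\<^sup>2] (mod int a * int b)"
      using cop by (simp add: coprime_cong_mult)
    then show ?L by auto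
  qed
  then show ?thesis using assms by (simp add: integral_distance_iff)
qed

lemma bij_betw_reduce:
  assumes "a > 0" and "b > 0" and "coprime a b"
  shows "bij_betw (\<lambda>u. (reduce a m u, reduce b m u)) (Zmod_space (a * b) m)
    (Zmod_space a m \<times> Zmod_space b m)"
proof (intro bij_betw_imageI inj_onI subset_antisym subsetI)
  have cop: "coprime (int a) (int b)" using assms by simp
  {
    fix u v
    assume uv: "u \<in> Zmod_space (a * b) m" "v \<in> Zmod_space (a * b) m"
      and eq: "(reduce a m u, reduce b m u) = (reduce a m v, reduce b m v)"
    show "u = v"
    proof (rule PiE_ext)
      fix i assume i: "i \<in> {1..m}"
      have "[u i = v i] (mod int a)" "[u i = v i] (mod int b)"
        using eq i by (simp_all add: reduce_def cong_def fun_eq_iff restrict_def) metis+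
      then have "[u i = v i] (mod int a * int b)"
        using cop by (simp add: coprime_cong_mult)
      moreover have "u i \<in> Zmod (a * b)" "v i \<in> Zmod (a * b)"
        using uv i by (auto simp: Zmod_space_def)
      \<comment> \<open>Both entries are canonical residues in \<open>{0..<a * b}\<close>, so their
        congruence modulo \<open>a * b\<close> is equality.\<close>
      ultimately show "u i = v i"
        by (auto simp: Zmod_def intro: cong_less_imp_eq_int)
    qed (use uv in \<open>auto simp: Zmod_space_def\<close>)
  next
    fix p assume "p \<in> (\<lambda>u. (reduce a m u, reduce b m u)) ` Zmod_space (a * b) m"
    then show "p \<in> Zmod_space a m \<times> Zmod_space b m"
      using assms by (auto simp: reduce_in_Zmod_space)
  next
    fix p assume "p \<in> Zmod_space a m \<times> Zmod_space b m"
    then obtain x y where p: "p = (x, y)" and x: "x \<in> Zmod_space a m" and y: "y \<in> Zmod_space b m"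
      by blast
    have "\<forall>i. \<exists>z. [z = x i] (mod int a) \<and> [z = y i] (mod int b)"
      using binary_chinese_remainder_int[OF cop] by blast
    then obtain w where w: "\<And>i. [w i = x i] (mod int a)" "\<And>i. [w i = y i] (mod int b)"
      by metis
    \<comment> \<open>The lift \<open>w\<close> has unbounded entries and is not extensional;
      reducing it yields a point over \<open>a * b\<close>. Since \<open>a\<close> and
      \<open>b\<close> divide \<open>a * b\<close>, reducing further still gives the residues of
      \<open>w\<close>, which are exactly the canonical entries of \<open>x\<close> and
      \<open>y\<close>.\<close>
    let ?u = "reduce (a * b) m w"
    have "reduce a m ?u = x"
      using x w(1) by (auto simp: fun_eq_iff reduce_def Zmod_space_def Zmod_def cong_def
          mod_mod_cancel PiE_iff extensional_def)
    moreover have "reduce b m ?u = y"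
      using y w(2) by (auto simp: fun_eq_iff reduce_def Zmod_space_def Zmod_def cong_def
          mod_mod_cancel PiE_iff extensional_def)
    ultimately show "p \<in> (\<lambda>u. (reduce a m u, reduce b m u)) ` Zmod_space (a * b) m"
      using assms p by (intro image_eqI[of _ _ ?u]) (auto intro!: reduce_in_Zmod_space)
  }
qed

lemma integral_point_set_reduce:
  assumes "n > 0" and "\<And>u v. u \<in> S \<Longrightarrow> v \<in> S \<Longrightarrow> integral_distance n m u v"
  shows "integral_point_set n m (reduce n m ` S)"
  using assms
  by (auto simp: integral_point_set_def pairwise_def integral_distance_reduce reduce_in_Zmod_space)

text \<open>\<open>pairwise\<close> covers only distinct points; the root 0 supplies the diagonal.
  The diagonal does occur: distinct points over \<open>a * b\<close> may coincide after reduction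
  modulo one factor.\<close>

lemma integral_distance_of_integral_point_set:
  "n > 0 \<Longrightarrow> integral_point_set n m S \<Longrightarrow> u \<in> S \<Longrightarrow> v \<in> S \<Longrightarrow> integral_distance n m u v"
  using integral_distance_refl by (cases "u = v") (auto simp: integral_point_set_def pairwise_def)

lemma card_le_max_integral_card:
  "integral_point_set n m S \<Longrightarrow> card S \<le> max_integral_card n m"
  unfolding max_integral_card_def by (rule Max_ge) (auto simp: finite_integral_point_sets)

lemma max_integral_card_attained:
  obtains S where "integral_point_set n m S" and "card S = max_integral_card n m"
proof -
  have "max_integral_card n m \<in> card ` {S. integral_point_set n m S}"
    unfolding max_integral_card_def
    using integral_point_set_empty by (intro Max_in) (auto simp: finite_integral_point_sets)
  then show ?thesis using that by auto
qed

lemma finite_integral_point_set: "integral_point_set n m S \<Longrightarrow> finite S"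
  by (rule finite_subset[of _ "Zmod_space n m"])
    (auto simp: integral_point_set_def Zmod_space_def Zmod_def finite_PiE)

theorem theorem3:
  fixes a b m :: nat
  assumes "a > 0" and "b > 0" and "coprime a b" and "m > 0"
  shows "max_integral_card (a * b) m = max_integral_card a m * max_integral_card b m"
proof (rule antisym)
  let ?f = "\<lambda>u. (reduce a m u, reduce b m u)"
  note dist_mult = integral_distance_mult_iff[OF assms(1-3)]
  note bij = bij_betw_reduce[OF assms(1-3), of m]
  have ab: "a * b > 0" using assms by simp
  show "max_integral_card (a * b) m \<le> max_integral_card a m * max_integral_card b m"
  proof -
    obtain P where P: "integral_point_set (a * b) m P" "card P = max_integral_card (a * b) m"
      by (rule max_integral_card_attained)
    have sets: "integral_point_set a m (reduce a m ` P)" "integral_point_set b m (reduce b m ` P)"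
      using integral_distance_of_integral_point_set[OF ab P(1)] assms dist_mult
      by (auto intro!: integral_point_set_reduce)
    have "inj_on ?f P"
      using bij P(1) by (auto simp: bij_betw_def integral_point_set_def intro: inj_on_subset)
    \<comment> \<open>Only an inequality: \<open>P\<close> embeds into the product of its
      projections but need not fill it.\<close>
    then have "card P \<le> card (reduce a m ` P \<times> reduce b m ` P)"
      using sets by (intro card_inj_on_le) (auto intro: finite_integral_point_set)
    also have "\<dots> \<le> max_integral_card a m * max_integral_card b m"
      using sets by (simp add: card_cartesian_product mult_le_mono card_le_max_integral_card)
    finally show ?thesis using P(2) by simp
  qed
  show "max_integral_card a m * max_integral_card b m \<le> max_integral_card (a * b) m"
  proof -
    obtain S where S: "integral_point_set a m S" "card S = max_integral_card a m"
      by (rule max_integral_card_attained)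
    obtain T where T: "integral_point_set b m T" "card T = max_integral_card b m"
      by (rule max_integral_card_attained)
    define P where "P = {u \<in> Zmod_space (a * b) m. ?f u \<in> S \<times> T}"
    have sub: "S \<times> T \<subseteq> Zmod_space a m \<times> Zmod_space b m"
      using S(1) T(1) by (auto simp: integral_point_set_def)
    have "P = Zmod_space (a * b) m \<inter> ?f -` (S \<times> T)"
      by (auto simp: P_def)
    then have "?f ` P = ?f ` Zmod_space (a * b) m \<inter> S \<times> T"
      by blast
    \<comment> \<open>Surjectivity of \<open>?f\<close> enters here: every pair in
      \<open>S \<times> T\<close> has a preimage, so none is lost in the count.\<close>
    then have "?f ` P = S \<times> T"
      using bij_betw_imp_surj_on[OF bij] sub by (simp only: Int_absorb1)
    moreover have "inj_on ?f P"
      using bij by (auto simp: bij_betw_def P_def intro: inj_on_subset)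
    ultimately have "card P = card S * card T"
      by (metis card_image card_cartesian_product)
    moreover have "integral_distance (a * b) m u v" if "u \<in> P" "v \<in> P" for u v
    proof -
      have "integral_distance a m (reduce a m u) (reduce a m v)"
        using that by (intro integral_distance_of_integral_point_set[OF assms(1) S(1)])
          (auto simp: P_def)
      moreover have "integral_distance b m (reduce b m u) (reduce b m v)"
        using that by (intro integral_distance_of_integral_point_set[OF assms(2) T(1)])
          (auto simp: P_def)
      ultimately show ?thesis
        using assms by (simp add: dist_mult integral_distance_reduce)
    qed
    then have "integral_point_set (a * b) m P"
      by (auto simp: integral_point_set_def pairwise_def P_def)
    ultimately show ?thesis
      using card_le_max_integral_card S(2) T(2) by metis
  qed
qed

end
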